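(* Let $p$ be a rational number in $(1/3,1/2]$ and let $\boldsymbol X=(X_1,X_2,X_3)$ be a random vector with probability mass function $f\in\mathcal{F}_3^{\Sigma}(p)$. Let $\phi_i(\nu^{\boldsymbol X})$ be the Shapley value of player $i$ in the variance game $\nu^{\boldsymbol X}$ associated with $\boldsymbol X$. Then, for $i=1,2,3$, $$\phi_i(\nu^{\boldsymbol X})=4p-1-3p^2-\mu_{kl},$$ where $\mu_{kl}=E[X_kX_l]$ and $i,k,l$ are distinct indices in $\{1,2,3\}$.
   Context: $\mathcal{F}_3(p)$ is the set of probability mass functions on $\{0,1\}^3$ whose three marginals are all Bernoulli with mean $p$. $\mathcal{F}_3^{\Sigma}(p)$ is the subset of $\Sigma$-countermonotonic pmfs in $\mathcal{F}_3(p)$, defined as follows. A bivariate random vector $(X,Y)$ is countermonotonic if $\mathbb{P}\{(X_1-X_2)(Y_1-Y_2)\le 0\}=1$ for independent copies $(X_1,Y_1),(X_2,Y_2)$ of $(X,Y)$. A random vector $(Y_1,\dots,Y_d)$ (and its pmf) is $\Sigma$-countermonotonic if for every $J\subseteq\{1,\dots,d\}$ the pair $(\sum_{j\in J}Y_j,\sum_{j\notin J}Y_j)$ is countermonotonic, with empty sums equal to $0$. Let $N=\{1,2,3\}$. A cooperative game on $N$ is a function $\nu$ from the subsets of $N$ to $\mathbb{R}$ with $\nu(\emptyset)=0$. The variance game of $\boldsymbol X$ is $\nu^{\boldsymbol X}(J)=V(S_J)$ for $J\subseteq N$, where $S_J=\sum_{j\in J}X_j$ and $V$ denotes variance. The Shapley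 value of player $i$ in a game $\nu$ is $$\phi_i(\nu)=\sum_{J\subseteq N\setminus\{i\}}\frac{|J|!\,(3-|J|-1)!}{3!}\bigl(\nu(J\cup\{i\})-\nu(J)\bigr).$$ *)

theory Defs
  imports "HOL-Probability.Probability"
begin

text \<open>The coordinate projections of \<open>M \<Otimes>\<^sub>M M\<close> are independent with law \<open>M\<close>, so
  \<open>(X \<circ> fst, Y \<circ> fst)\<close> and \<open>(X \<circ> snd, Y \<circ> snd)\<close> are independent copies of \<open>(X, Y)\<close>.\<close>

definition countermonotonic :: "'a measure \<Rightarrow> ('a \<Rightarrow> real) \<Rightarrow> ('a \<Rightarrow> real) \<Rightarrow> bool" where
  "countermonotonic M X Y \<longleftrightarrow>
     \<P>(z in M \<Otimes>\<^sub>M M. (X (fst z) - X (snd z)) * (Y (fst z) - Y (snd z)) \<le> 0) = 1"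

definition partial_sum :: "('a \<Rightarrow> real ^ 'd) \<Rightarrow> 'd::finite set \<Rightarrow> 'a \<Rightarrow> real" where
  "partial_sum X J \<omega> = (\<Sum>j\<in>J. X \<omega> $ j)"

definition Sigma_countermonotonic :: "'a measure \<Rightarrow> ('a \<Rightarrow> real ^ 'd::finite) \<Rightarrow> bool" where
  "Sigma_countermonotonic M Y \<longleftrightarrow>
     (\<forall>J. countermonotonic M (partial_sum Y J) (partial_sum Y (- J)))"

text \<open>The property only depends on the joint law; for a pmf \<open>f\<close> it is stated for the identity
  random vector on the probability space \<open>measure_pmf f\<close>.\<close>

definition Sigma_countermonotonic_pmf :: "(real ^ 'd::finite) pmf \<Rightarrow> bool" where
  "Sigma_countermonotonic_pmf f \<longleftrightarrow> Sigma_countermonotonic (measure_pmf f) (\<lambda>x. x)"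

text \<open>In the index type \<open>3\<close> the numeral \<open>3\<close> denotes \<open>0\<close>, so its elements are exactly \<open>1, 2, 3\<close>.\<close>

definition F3 :: "real \<Rightarrow> (real ^ 3) pmf set" where
  "F3 p = {f. set_pmf f \<subseteq> {x. \<forall>i. x $ i \<in> {0, 1}} \<and>
              (\<forall>i. map_pmf (\<lambda>x. x $ i) f = map_pmf of_bool (bernoulli_pmf p))}"

definition F3_Sigma :: "real \<Rightarrow> (real ^ 3) pmf set" where
  "F3_Sigma p = {f \<in> F3 p. Sigma_countermonotonic_pmf f}"

definition has_pmf :: "'a measure \<Rightarrow> ('a \<Rightarrow> real ^ 'd::finite) \<Rightarrow> (real ^ 'd) pmf \<Rightarrow> bool" where
  "has_pmf M X f \<longleftrightarrow> X \<in> borel_measurable M \<and> (\<forall>x. \<P>(\<omega> in M. X \<omega> = x) = pmf f x)"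

definition variance_game :: "'a measure \<Rightarrow> ('a \<Rightarrow> real ^ 'd::finite) \<Rightarrow> 'd set \<Rightarrow> real" where
  "variance_game M X J = prob_space.variance M (partial_sum X J)"

lemma variance_game_empty: "variance_game M X {} = 0"
proof -
  have "partial_sum X {} = (\<lambda>_. 0)"
    by (simp add: partial_sum_def fun_eq_iff)
  then show ?thesis
    by (simp add: variance_game_def)
qed

text \<open>The player set is the whole index type \<open>'d\<close>; for \<open>'d = 3\<close> we have \<open>CARD('d) = 3\<close>.\<close>

definition shapley :: "('d::finite set \<Rightarrow> real) \<Rightarrow> 'd \<Rightarrow> real" where
  "shapley \<nu> i =
     (\<Sum>J \<in> Pow (UNIV - {i}).
        fact (card J) * fact (CARD('d) - card J - 1) / fact CARD('d) * (\<nu> (insert i J) - \<nu> J))"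

end

theory Submission
  imports Defs
begin

text \<open>If a \<open>\<Sigma>\<close>-countermonotonic pmf charges \<open>(0,0,0)\<close>, comparing it with any other support
  point, with \<open>J\<close> a singleton, shows that at most one component is \<open>1\<close>, so the mean \<open>3p\<close> of the sum
  is at most \<open>1\<close>; if it charges \<open>(1,1,1)\<close>, then likewise \<open>3p \<ge> 2\<close>. Both are excluded by
  \<open>1/3 < p \<le> 1/2\<close>, so the sum only takes the values \<open>1\<close> and \<open>2\<close>. For such \<open>0\<close>-\<open>1\<close> vectors the sum
  of the pairwise products is the sum of the components minus \<open>1\<close>, hence
  \<open>\<mu>\<^sub>1\<^sub>2 + \<mu>\<^sub>1\<^sub>3 + \<mu>\<^sub>2\<^sub>3 = 3p - 1\<close>. On the other hand the Shapley value of \<open>i\<close> in the variance game is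
  the covariance of \<open>X\<^sub>i\<close> with the total sum, \<open>p - 3p\<^sup>2 + \<mu>\<^sub>i\<^sub>k + \<mu>\<^sub>i\<^sub>l\<close>.\<close>

text \<open>\<open>has_pmf\<close> prescribes point probabilities only. They determine the law on
  countable sets and already add up to 1 on the countable set \<open>set_pmf f\<close>, so no mass
  is left elsewhere. Pushing \<open>measure_pmf f\<close> to \<open>borel\<close> gives both laws
  the same measurable sets.\<close>

lemma distr_eq_if_has_pmf:
  assumes "prob_space M" and "has_pmf M X f"
  shows "distr M borel X = distr (measure_pmf f) borel (\<lambda>x. x)"
    and "AE \<omega> in M. X \<omega> \<in> set_pmf f"
proof -
  interpret prob_space M by fact
  have X [measurable]: "X \<in> borel_measurable M"
    and pmf: "\<And>x. \<P>(\<omega> in M. X \<omega> = x) = pmf f x"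
    using assms(2) by (auto simp: has_pmf_def)
  interpret D: prob_space "distr M borel X"
    by (rule prob_space_distr) simp
  have singleton: "emeasure (distr M borel X) {x} = emeasure (measure_pmf f) {x}" for x
    by (subst emeasure_distr)
      (auto simp: emeasure_eq_measure emeasure_pmf_single pmf[symmetric] vimage_def Int_def
        intro!: arg_cong[of _ _ prob])
  have borel: "B \<in> sets borel" if "countable B" for B :: "(real ^ 'b) set"
    by (rule sets.countable) (use that in auto)
  have countable_eq: "emeasure (distr M borel X) B = emeasure (measure_pmf f) B"
    if "countable B" for B
    using that by (simp add: emeasure_countable_singleton[of B] singleton)
  have "emeasure (distr M borel X) (set_pmf f) = 1"
    by (simp add: countable_eq countable_set_pmf measure_pmf.emeasure_eq_measure
        measure_pmf.prob_eq_1 AE_measure_pmf)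
  then have AE_D: "AE x in distr M borel X. x \<in> set_pmf f"
    by (intro D.AE_prob_1) (simp add: D.emeasure_eq_measure)
  then show "AE \<omega> in M. X \<omega> \<in> set_pmf f"
    by (rule AE_distrD[rotated]) simp
  show "distr M borel X = distr (measure_pmf f) borel (\<lambda>x. x)"
  proof (rule measure_eqI)
    fix A assume "A \<in> sets (distr M borel X)"
    then have A: "A \<in> sets borel" by simp
    \<comment> \<open>Neither law has mass outside the support, so \<open>A\<close> may be cut down
      to a countable set.\<close>
    have "emeasure (distr M borel X) A = emeasure (distr M borel X) (A \<inter> set_pmf f)"
      using AE_D A borel[OF countable_set_pmf, of f] by (intro emeasure_eq_AE) auto
    also have "\<dots> = emeasure (measure_pmf f) (A \<inter> set_pmf f)"
      by (rule countable_eq) (simp add: countable_Int2 countable_set_pmf)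
    also have "\<dots> = emeasure (measure_pmf f) A"
      by (rule emeasure_Int_set_pmf)
    also have "\<dots> = emeasure (distr (measure_pmf f) borel (\<lambda>x. x)) A"
      using A by (simp add: emeasure_distr)
    finally show "emeasure (distr M borel X) A = emeasure (distr (measure_pmf f) borel (\<lambda>x. x)) A" .
  qed simp
qed

lemma expectation_eq_if_has_pmf:
  fixes g :: "real ^ 'd::finite \<Rightarrow> real"
  assumes "prob_space M" and "has_pmf M X f" and [measurable]: "g \<in> borel_measurable borel"
  shows "prob_space.expectation M (\<lambda>\<omega>. g (X \<omega>)) = measure_pmf.expectation f g"
proof -
  have [measurable]: "X \<in> borel_measurable M"
    using assms(2) by (simp add: has_pmf_def)
  have "prob_space.expectation M (\<lambda>\<omega>. g (X \<omega>)) = integral\<^sup>L (distr M borel X) g"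
    by (rule integral_distr[symmetric]) auto
  also have "\<dots> = measure_pmf.expectation f g"
    by (simp add: distr_eq_if_has_pmf(1)[OF assms(1,2)] integral_distr)
  finally show ?thesis .
qed

text \<open>Support points are atoms, so what holds almost surely for two independent copies holds
  for every pair of support points.\<close>

lemma Sigma_countermonotonic_pmfD:
  assumes "Sigma_countermonotonic_pmf f" and "x \<in> set_pmf f" and "y \<in> set_pmf f"
  shows "((\<Sum>j\<in>J. x $ j) - (\<Sum>j\<in>J. y $ j)) * ((\<Sum>j\<in>-J. x $ j) - (\<Sum>j\<in>-J. y $ j)) \<le> 0"
proof -
  interpret pair_prob_space "measure_pmf f" "measure_pmf f" ..
  let ?s = "\<lambda>J. partial_sum (\<lambda>x. x) J"
  have "\<P>(z in measure_pmf f \<Otimes>\<^sub>M measure_pmf f.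
      (?s J (fst z) - ?s J (snd z)) * (?s (- J) (fst z) - ?s (- J) (snd z)) \<le> 0) = 1"
    using assms(1)
    by (simp add: Sigma_countermonotonic_pmf_def Sigma_countermonotonic_def countermonotonic_def)
  from P.AE_prob_1[OF this]
  have "AE z in measure_pmf f \<Otimes>\<^sub>M measure_pmf f.
      (?s J (fst z) - ?s J (snd z)) * (?s (- J) (fst z) - ?s (- J) (snd z)) \<le> 0"
    by eventually_elim auto
  from AE_pair[OF this] assms(2,3) show ?thesis
    by (simp add: AE_measure_pmf_iff partial_sum_def)
qed

text \<open>The bounds on \<open>p\<close> matter because \<open>bernoulli_pmf\<close> truncates its
  parameter to the unit interval.\<close>

lemma F3_expectation:
  assumes "f \<in> F3 p" and "0 \<le> p" and "p \<le> 1"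
  shows "measure_pmf.expectation f (\<lambda>x. x $ i) = p"
proof -
  have "measure_pmf.expectation f (\<lambda>x. x $ i) = measure_pmf.expectation (map_pmf (\<lambda>x. x $ i) f) (\<lambda>y. y)"
    by simp
  also have "map_pmf (\<lambda>x. x $ i) f = map_pmf of_bool (bernoulli_pmf p)"
    using assms(1) by (simp add: F3_def)
  also have "measure_pmf.expectation \<dots> (\<lambda>y. y) = p"
    using assms(2,3) by simp
  finally show ?thesis .
qed

lemma F3_Sigma_sum_values:
  assumes "f \<in> F3_Sigma p" and "1 / 3 < p" and "p \<le> 1 / 2" and "x \<in> set_pmf f"
  shows "x $ 1 + x $ 2 + x $ 3 \<in> {1, 2}"
proof -
  have F3: "f \<in> F3 p" and Sigma: "Sigma_countermonotonic_pmf f"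
    using assms(1) by (auto simp: F3_Sigma_def)
  have bin: "y $ j = 0 \<or> y $ j = 1" if "y \<in> set_pmf f" for y j
    using F3 that by (auto simp: F3_def)
  have compl: "- {1} = {2, 3 :: 3}" "- {2} = {1, 3 :: 3}" "- {3} = {1, 2 :: 3}"
    using exhaust_3 by (force simp: set_eq_iff)+
  have cm: "(x $ 1 - y $ 1) * (x $ 2 + x $ 3 - (y $ 2 + y $ 3)) \<le> 0"
    "(x $ 2 - y $ 2) * (x $ 1 + x $ 3 - (y $ 1 + y $ 3)) \<le> 0"
    "(x $ 3 - y $ 3) * (x $ 1 + x $ 2 - (y $ 1 + y $ 2)) \<le> 0" if "y \<in> set_pmf f" for y
    using Sigma_countermonotonic_pmfD[OF Sigma assms(4) that, of "{1}"]
      Sigma_countermonotonic_pmfD[OF Sigma assms(4) that, of "{2}"]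
      Sigma_countermonotonic_pmfD[OF Sigma assms(4) that, of "{3}"]
    by (simp_all add: compl)
  have int: "integrable (measure_pmf f) (\<lambda>y. y $ j)" for j
  proof (rule measure_pmf.integrable_const_bound[where B = 1])
    show "AE y in measure_pmf f. norm (y $ j) \<le> 1"
      unfolding AE_measure_pmf_iff using bin[of _ j] by force
  qed simp
  have mean: "measure_pmf.expectation f (\<lambda>y. y $ 1 + y $ 2 + y $ 3) = 3 * p"
    using F3_expectation[OF F3] assms(2,3) by (simp add: int)
  have "x $ 1 + x $ 2 + x $ 3 \<noteq> 0"
  proof
    assume "x $ 1 + x $ 2 + x $ 3 = 0"
    then have "x $ 1 = 0" "x $ 2 = 0" "x $ 3 = 0"
      using bin[OF assms(4), of 1] bin[OF assms(4), of 2] bin[OF assms(4), of 3] by auto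
    \<comment> \<open>With \<open>x\<close> zero, \<open>cm\<close> says that \<open>y $ j\<close>
      times the sum of the other two components is \<le> 0: a component 1 forces the others to
      vanish.\<close>
    then have "y $ 1 + y $ 2 + y $ 3 \<le> 1" if "y \<in> set_pmf f" for y
      using cm[OF that] bin[OF that, of 1] bin[OF that, of 2] bin[OF that, of 3] by auto
    then have "measure_pmf.expectation f (\<lambda>y. y $ 1 + y $ 2 + y $ 3) \<le> 1"
      by (intro measure_pmf.integral_le_const) (auto simp: int AE_measure_pmf_iff)
    with mean assms(2) show False by simp
  qed
  moreover have "x $ 1 + x $ 2 + x $ 3 \<noteq> 3"
  proof
    assume "x $ 1 + x $ 2 + x $ 3 = 3"
    then have "x $ 1 = 1" "x $ 2 = 1" "x $ 3 = 1"
      using bin[OF assms(4), of 1] bin[OF assms(4), of 2] bin[OF assms(4), of 3] by auto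
    \<comment> \<open>Here \<open>cm\<close> says that \<open>1 - y $ j\<close> times 2 minus the
      sum of the other two components is \<le> 0: a component 0 forces the others to be 1.\<close>
    then have "2 \<le> y $ 1 + y $ 2 + y $ 3" if "y \<in> set_pmf f" for y
      using cm[OF that] bin[OF that, of 1] bin[OF that, of 2] bin[OF that, of 3] by auto
    then have "2 \<le> measure_pmf.expectation f (\<lambda>y. y $ 1 + y $ 2 + y $ 3)"
      by (intro measure_pmf.integral_ge_const) (auto simp: int AE_measure_pmf_iff)
    with mean assms(3) show False by simp
  qed
  ultimately show ?thesis
    using bin[OF assms(4), of 1] bin[OF assms(4), of 2] bin[OF assms(4), of 3] by auto
qed

text \<open>Bilinearity of covariance: the square of a sum is a double sum, so the covariances of
  all ordered pairs from \<open>J\<close> occur, diagonal included.\<close>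

lemma variance_game_eq_sum:
  assumes "prob_space M"
    and int: "\<And>j. integrable M (\<lambda>\<omega>. X \<omega> $ j)" "\<And>j k. integrable M (\<lambda>\<omega>. X \<omega> $ j * X \<omega> $ k)"
  shows "variance_game M X J =
    (\<Sum>j\<in>J. \<Sum>k\<in>J. prob_space.expectation M (\<lambda>\<omega>. X \<omega> $ j * X \<omega> $ k) -
      prob_space.expectation M (\<lambda>\<omega>. X \<omega> $ j) * prob_space.expectation M (\<lambda>\<omega>. X \<omega> $ k))"
proof -
  interpret prob_space M by fact
  have sq: "(partial_sum X J \<omega>)\<^sup>2 = (\<Sum>j\<in>J. \<Sum>k\<in>J. X \<omega> $ j * X \<omega> $ k)" for \<omega>
    by (simp add: partial_sum_def power2_eq_square sum_product)
  have "variance (partial_sum X J) = expectation (\<lambda>\<omega>. (partial_sum X J \<omega>)\<^sup>2) - (expectation (partial_sum X J))\<^sup>2"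
    by (rule variance_eq) (simp_all only: sq, simp_all add: partial_sum_def int)
  moreover have "expectation (partial_sum X J) = (\<Sum>j\<in>J. expectation (\<lambda>\<omega>. X \<omega> $ j))"
    by (simp add: partial_sum_def[abs_def] int)
  moreover have "expectation (\<lambda>\<omega>. (partial_sum X J \<omega>)\<^sup>2)
      = (\<Sum>j\<in>J. \<Sum>k\<in>J. expectation (\<lambda>\<omega>. X \<omega> $ j * X \<omega> $ k))"
    by (simp add: sq int)
  ultimately show ?thesis
    by (simp add: variance_game_def power2_eq_square sum_product sum_subtractf)
qed

text \<open>The weights are 0! 2! / 3! = 1/3, 1! 1! / 3! = 1/6 and 2! 0! / 3! = 1/3 for coalitions
  of size 0, 1 and 2.\<close>

lemma shapley_three_players:
  fixes i k l :: 3
  assumes "i \<noteq> k" and "i \<noteq> l" and "k \<noteq> l"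
  shows "shapley \<nu> i = (\<nu> {i} - \<nu> {}) / 3 + (\<nu> {i, k} - \<nu> {k}) / 6 + (\<nu> {i, l} - \<nu> {l}) / 6
    + (\<nu> {i, k, l} - \<nu> {k, l}) / 3"
proof -
  have "UNIV - {i} = {k, l}"
    using assms exhaust_3[of i] exhaust_3[of k] exhaust_3[of l] by (auto simp: UNIV_3)
  then have "Pow (UNIV - {i}) = {{}, {k}, {l}, {k, l}}" by auto
  then show ?thesis
    using assms by (simp add: shapley_def doubleton_eq_iff fact_numeral field_simps insert_commute)
qed

theorem proposition4p1:
  fixes p :: real
    and M :: "'a measure"
    and X :: "'a \<Rightarrow> real ^ 3"
    and f :: "(real ^ 3) pmf"
    and i k l :: 3
  assumes "p \<in> \<rat>" and "1 / 3 < p" and "p \<le> 1 / 2"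
    and "prob_space M"
    and "f \<in> F3_Sigma p"
    and "has_pmf M X f"
    and "i \<noteq> k" and "i \<noteq> l" and "k \<noteq> l"
  shows "shapley (variance_game M X) i =
           4 * p - 1 - 3 * p\<^sup>2 - prob_space.expectation M (\<lambda>\<omega>. X \<omega> $ k * X \<omega> $ l)"
proof -
  interpret prob_space M by fact
  have F3: "f \<in> F3 p"
    using assms(5) by (simp add: F3_Sigma_def)
  have [measurable]: "(\<lambda>\<omega>. X \<omega> $ j) \<in> borel_measurable M" for j
    using assms(6) by (auto simp: has_pmf_def intro: measurable_compose[OF _ borel_measurable_nth])
  have supp: "AE \<omega> in M. X \<omega> \<in> set_pmf f"
    by (rule distr_eq_if_has_pmf(2)) fact+
  have bin: "x $ j = 0 \<or> x $ j = 1" if "x \<in> set_pmf f" for x j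
    using F3 that by (auto simp: F3_def)
  have int: "integrable M (\<lambda>\<omega>. X \<omega> $ j)" for j
  proof (rule integrable_const_bound[where B = 1])
    show "AE \<omega> in M. norm (X \<omega> $ j) \<le> 1"
      using supp by eventually_elim (use bin[of _ j] in force)
  qed measurable
  have int2: "integrable M (\<lambda>\<omega>. X \<omega> $ j * X \<omega> $ j')" for j j'
  proof (rule integrable_const_bound[where B = 1])
    show "AE \<omega> in M. norm (X \<omega> $ j * X \<omega> $ j') \<le> 1"
      using supp by eventually_elim (use bin[of _ j] bin[of _ j'] in force)
  qed measurable
  have mean: "expectation (\<lambda>\<omega>. X \<omega> $ j) = p" for j
    using expectation_eq_if_has_pmf[OF assms(4,6), of "\<lambda>x. x $ j"] F3_expectation[OF F3] assms(2,3)
    by simp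
  define \<mu> where "\<mu> j j' = expectation (\<lambda>\<omega>. X \<omega> $ j * X \<omega> $ j')" for j j'
  \<comment> \<open>A 0-1 variable equals its square.\<close>
  have diag: "\<mu> j j = p" for j
  proof -
    have "\<mu> j j = expectation (\<lambda>\<omega>. X \<omega> $ j)"
      unfolding \<mu>_def
    proof (rule integral_cong_AE)
      show "AE \<omega> in M. X \<omega> $ j * X \<omega> $ j = X \<omega> $ j"
        using supp by eventually_elim (use bin[of _ j] in force)
    qed measurable
    then show ?thesis by (simp add: mean)
  qed
  have sym: "\<mu> j j' = \<mu> j' j" for j j'
    by (simp add: \<mu>_def mult.commute)
  have "\<mu> i k + \<mu> i l + \<mu> k l
      = expectation (\<lambda>\<omega>. X \<omega> $ i * X \<omega> $ k + X \<omega> $ i * X \<omega> $ l + X \<omega> $ k * X \<omega> $ l)"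
    by (simp add: \<mu>_def int2)
  \<comment> \<open>With s ones there are s (s - 1) / 2 pairs of ones, and this equals s - 1 exactly
    when s is 1 or 2.\<close>
  also have "\<dots> = expectation (\<lambda>\<omega>. X \<omega> $ i + X \<omega> $ k + X \<omega> $ l - 1)"
  proof (rule integral_cong_AE)
    show "AE \<omega> in M. X \<omega> $ i * X \<omega> $ k + X \<omega> $ i * X \<omega> $ l + X \<omega> $ k * X \<omega> $ l
        = X \<omega> $ i + X \<omega> $ k + X \<omega> $ l - 1"
      using supp
    proof eventually_elim
      case (elim \<omega>)
      have "X \<omega> $ i + X \<omega> $ k + X \<omega> $ l = X \<omega> $ 1 + X \<omega> $ 2 + X \<omega> $ 3"
        using assms(7-9) exhaust_3[of i] exhaust_3[of k] exhaust_3[of l] by auto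
      then have "X \<omega> $ i + X \<omega> $ k + X \<omega> $ l \<in> {1, 2}"
        using F3_Sigma_sum_values[OF assms(5,2,3) elim] by simp
      then show ?case
        using bin[OF elim, of i] bin[OF elim, of k] bin[OF elim, of l] by auto
    qed
  qed measurable
  also have "\<dots> = 3 * p - 1"
    by (simp add: int mean prob_space)
  finally have pairs: "\<mu> i k + \<mu> i l + \<mu> k l = 3 * p - 1" .
  have game: "variance_game M X J = (\<Sum>j\<in>J. \<Sum>j'\<in>J. \<mu> j j' - p * p)" for J
    by (simp add: variance_game_eq_sum[OF assms(4) int int2] mean \<mu>_def)
  \<comment> \<open>Joining \<open>J\<close> adds the variance of component \<open>i\<close> plus
    twice its covariances with \<open>J\<close>. The weights sum to 1, and those of the coalitions
    containing \<open>k\<close> (likewise \<open>l\<close>) to 1/6 + 1/3 = 1/2, so each covariance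
    is counted once.\<close>
  have "shapley (variance_game M X) i = p - 3 * p\<^sup>2 + \<mu> i k + \<mu> i l"
    using assms(7-9)
    by (simp add: shapley_three_players[OF assms(7-9)] game diag sym[of k i] sym[of l i] sym[of l k]
        power2_eq_square field_simps)
  \<comment> \<open>\<open>pairs\<close> trades \<open>\<mu> i k + \<mu> i l\<close> for
    \<open>3 * p - 1 - \<mu> k l\<close>.\<close>
  then show ?thesis
    using pairs by (simp add: \<mu>_def)
qed

end
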